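(* Let $G\subseteq K_{m,n}$ be a connected bipartite graph. For any triangulation $\{\Delta_{T_1},\dots,\Delta_{T_s}\}$ of the root polytope $Q_G$, the set of right degree vectors $\{RD(T_1),\dots,RD(T_s)\}$ is exactly the set of lattice points in the trimmed generalized permutohedron $P_G^-$ (without repetitions, i.e. the vectors $RD(T_1),\dots,RD(T_s)$ are pairwise distinct). Similarly, the set of left degree vectors $\{LD(T_1),\dots,LD(T_s)\}$ is exactly the set of lattice points in the polytope $P_{G^*}^-$ for the mirror image $G^*$ of the graph $G$ (again without repetitions).
   Context: $[n]=\{1,\dots,n\}$; $m,n\ge1$. The vertices of $G\subseteq K_{m,n}$ are labeled $1,\dots,m$ (left) and $\bar1,\dots,\bar n$ (right). Let $e_1,\dots,e_m,e_{\bar1},\dots,e_{\bar n}$ be the coordinate vectors in $\mathbb{R}^{m+n}$. The root polytope is $Q_G=\mathrm{ConvexHull}(e_i-e_{\bar j}\mid(i,\bar j)\text{ an edge of }G)\subset\mathbb{R}^{m+n}$, of dimension $m+n-2$. For a forest $F\subseteq G$, $\Delta_F=\mathrm{ConvexHull}(e_i-e_{\bar j}\mid(i,\bar j)\text{ an edge of }F)$, which is a simplex; the $(m+n-2)$-dimensional simplices whose vertices are vertices of $Q_G$ are exactly the $\Delta_T$ for spanning trees $T$ of $G$. A triangulation of $Q_G$ is a collection $\{\Delta_{T_1},\dots,\Delta_{T_s}\}$ of distinct simplices, for spanning trees $T_1,\dots,T_s$ of $G$, such that $Q_G=\bigcup_i\Delta_{T_i}$ and each intersection $\Delta_{T_i}\cap\Delta_{T_j}$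 is a common face of the two simplices. For a spanning tree $T$, $LD(T)=(d_1,\dots,d_m)$ and $RD(T)=(d_{\bar1},\dots,d_{\bar n})$, where $d_i=\deg_i(T)-1$ and $d_{\bar j}=\deg_{\bar j}(T)-1$ are the degrees of the vertices $i$ and $\bar j$ in $T$ minus $1$. Let $I_i=\{j\in[n]\mid(i,\bar j)\in G\}$, and for nonempty $I\subseteq[n]$ let $\Delta_I\subset\mathbb{R}^n$ be the convex hull of the coordinate vectors of $\mathbb{R}^n$ indexed by $I$. Let $P_G=\Delta_{I_1}+\cdots+\Delta_{I_m}\subset\mathbb{R}^n$ (Minkowski sum) and $P_G^-=\{x\in\mathbb{R}^n\mid x+\Delta_{[n]}\subseteq P_G\}$. The mirror image $G^*\subseteq K_{n,m}$ has edge $(j,\bar i)$ if and only if $(i,\bar j)$ is an edge of $G$; thus $P_{G^*}^-=\{x\in\mathbb{R}^m\mid x+\Delta_{[m]}\subseteq\Delta_{I_1^*}+\cdots+\Delta_{I_n^*}\}$ with $I_j^*=\{i\in[m]\mid(i,\bar j)\in G\}$. Lattice points are points with integer coordinates. *)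

theory Defs
  imports "HOL-Analysis.Analysis"
begin

text \<open>
  The left vertices are the elements of a finite type \<open>'m\<close>, the right vertices those of a finite
  type \<open>'n\<close>; a subgraph of the complete bipartite graph is its set of edges
  \<open>G :: ('m \<times> 'n) set\<close>, always taken with the full vertex set \<open>'m + 'n\<close>.
\<close>

definition adjacency :: "('m \<times> 'n) set \<Rightarrow> (('m + 'n) \<times> ('m + 'n)) set" where
  "adjacency G = {(Inl i, Inr j) | i j. (i, j) \<in> G} \<union> {(Inr j, Inl i) | i j. (i, j) \<in> G}"

definition connected_graph :: "('m \<times> 'n) set \<Rightarrow> bool" where
  "connected_graph G \<longleftrightarrow> (\<forall>u v. (u, v) \<in> (adjacency G)\<^sup>*)"

definition is_cycle :: "('m \<times> 'n) set \<Rightarrow> ('m + 'n) list \<Rightarrow> bool" where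
  "is_cycle G vs \<longleftrightarrow> 3 \<le> length vs \<and> distinct vs \<and>
     (\<forall>k < length vs. (vs ! k, vs ! (Suc k mod length vs)) \<in> adjacency G)"

definition spanning_tree :: "('m \<times> 'n) set \<Rightarrow> ('m \<times> 'n) set \<Rightarrow> bool" where
  "spanning_tree G T \<longleftrightarrow> T \<subseteq> G \<and> connected_graph T \<and> (\<nexists>vs. is_cycle T vs)"

text \<open>
  This is \<open>Q\<^sub>G\<close> for a graph \<open>G\<close>, and also \<open>\<Delta>\<^sub>F\<close> when applied to a forest \<open>F\<close>.
\<close>

definition root_polytope :: "('m::finite \<times> 'n::finite) set \<Rightarrow> (real ^ ('m + 'n)) set" where
  "root_polytope G = convex hull {axis (Inl i) 1 - axis (Inr j) 1 | i j. (i, j) \<in> G}"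

text \<open>
  The simplices are indexed by \<open>1, \<dots>, s\<close>; injectivity says that they are distinct.
\<close>

definition root_triangulation ::
    "('m::finite \<times> 'n::finite) set \<Rightarrow> nat \<Rightarrow> (nat \<Rightarrow> ('m \<times> 'n) set) \<Rightarrow> bool" where
  "root_triangulation G s T \<longleftrightarrow>
     (\<forall>k\<in>{1..s}. spanning_tree G (T k)) \<and>
     inj_on (\<lambda>k. root_polytope (T k)) {1..s} \<and>
     root_polytope G = (\<Union>k\<in>{1..s}. root_polytope (T k)) \<and>
     (\<forall>k\<in>{1..s}. \<forall>l\<in>{1..s}.
        (root_polytope (T k) \<inter> root_polytope (T l)) face_of root_polytope (T k) \<and>
        (root_polytope (T k) \<inter> root_polytope (T l)) face_of root_polytope (T l))"

definition left_degree_vector :: "('m::finite \<times> 'n::finite) set \<Rightarrow> real ^ 'm" where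
  "left_degree_vector T = (\<chi> i. real (card {j. (i, j) \<in> T}) - 1)"

definition right_degree_vector :: "('m::finite \<times> 'n::finite) set \<Rightarrow> real ^ 'n" where
  "right_degree_vector T = (\<chi> j. real (card {i. (i, j) \<in> T}) - 1)"

definition coord_simplex :: "'n::finite set \<Rightarrow> (real ^ 'n) set" where
  "coord_simplex I = convex hull ((\<lambda>j. axis j 1) ` I)"

text \<open>
  The sum below is the Minkowski sum of sets from \<open>HOL-Library.Set_Algebras\<close>.
\<close>

definition gen_permutohedron :: "('m::finite \<times> 'n::finite) set \<Rightarrow> (real ^ 'n) set" where
  "gen_permutohedron G = (\<Sum>i\<in>UNIV. coord_simplex {j. (i, j) \<in> G})"

definition trimmed_permutohedron :: "('m::finite \<times> 'n::finite) set \<Rightarrow> (real ^ 'n) set" where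
  "trimmed_permutohedron G = {x. (\<lambda>y. x + y) ` coord_simplex UNIV \<subseteq> gen_permutohedron G}"

definition lattice_points :: "(real ^ 'n) set \<Rightarrow> (real ^ 'n) set" where
  "lattice_points S = {x \<in> S. \<forall>j. x $ j \<in> \<int>}"

end

theory Submission
  imports Defs
begin

text \<open>
  Let \<open>x\<close> be an integer vector with coordinate sum \<open>m - 1\<close>, and let \<open>z\<close> be the point of the space
  of \<open>Q\<^sub>G\<close> with left coordinates \<open>1/m\<close> and right coordinates \<open>-(x\<^sub>j + 1/n)/m\<close>. Points of \<open>\<Delta>\<^sub>T\<close> are
  nonnegative flows on \<open>T\<close>. If \<open>z\<close> lies in \<open>\<Delta>\<^sub>T\<close>, then, rescaling by \<open>m\<close>, no edge carries more than \<open>1\<close>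
  while \<open>x\<^sub>j + 1/n\<close> flows into \<open>j\<close>, so \<open>j\<close> has degree at least \<open>x\<^sub>j + 1\<close>; as \<open>T\<close> has \<open>m + n - 1\<close> edges,
  \<open>RD(T) = x\<close>. Conversely, if \<open>RD(T) = x\<close>, root \<open>T\<close> at a right vertex \<open>r\<close> and send one unit from each
  left vertex to its parent: this realises \<open>x + e\<^sub>r\<close>, so \<open>x \<in> P\<^sub>G\<^sup>-\<close>, and the average
  over all \<open>r\<close> is positive on every edge, so \<open>z\<close> lies in the relative interior of \<open>\<Delta>\<^sub>T\<close>.
  Hence the simplices of a triangulation with \<open>RD(T) = x\<close> are exactly those containing \<open>z\<close>; there
  is one if \<open>x \<in> P\<^sub>G\<^sup>-\<close>, and only one because simplices meet in common faces.
\<close>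

section \<open>Rooted spanning trees\<close>

lemma Inl_Inr_in_adjacency [simp]: "(Inl i, Inr j) \<in> adjacency G \<longleftrightarrow> (i, j) \<in> G"
  and Inr_Inl_in_adjacency [simp]: "(Inr j, Inl i) \<in> adjacency G \<longleftrightarrow> (i, j) \<in> G"
  and Inl_Inl_notin_adjacency [simp]: "(Inl i, Inl i') \<notin> adjacency G"
  and Inr_Inr_notin_adjacency [simp]: "(Inr j, Inr j') \<notin> adjacency G"
  by (auto simp: adjacency_def)

lemma sym_adjacency: "sym (adjacency G)"
  by (auto simp: adjacency_def sym_def)

lemma adjacency_mono: "G \<subseteq> H \<Longrightarrow> adjacency G \<subseteq> adjacency H"
  by (auto simp: adjacency_def)

text \<open>A walk is shortened as it grows: when the next vertex already occurs, the path is cut at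
  that occurrence, otherwise it is extended.\<close>

lemma rtrancl_imp_distinct_path:
  assumes "(u, v) \<in> R\<^sup>*"
  shows "\<exists>xs. xs \<noteq> [] \<and> hd xs = u \<and> last xs = v \<and> distinct xs \<and>
    successively (\<lambda>a b. (a, b) \<in> R) xs"
  using assms
proof (induction rule: rtrancl_induct)
  case base
  show ?case by (rule exI[of _ "[u]"]) auto
next
  case (step y z)
  then obtain xs where xs: "xs \<noteq> []" "hd xs = u" "last xs = y" "distinct xs"
    "successively (\<lambda>a b. (a, b) \<in> R) xs" by auto
  show ?case
  proof (cases "z \<in> set xs")
    case True
    then obtain ys zs where "xs = ys @ z # zs" by (meson split_list)
    with xs show ?thesis
      by (intro exI[of _ "ys @ [z]"]) (auto simp: successively_append_iff hd_append)
  next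
    case False
    with xs step.hyps show ?thesis
      by (intro exI[of _ "xs @ [z]"]) (auto simp: successively_append_iff)
  qed
qed

text \<open>A simple path from \<open>Inl a\<close> to \<open>Inr b\<close> avoiding the edge would
  close up with that edge to a cycle.\<close>

lemma acyclic_edge_is_bridge:
  assumes acyc: "\<nexists>vs. is_cycle T vs" and e: "(a, b) \<in> T"
  shows "(Inl a, Inr b) \<notin> (adjacency (T - {(a, b)}))\<^sup>*"
proof
  assume "(Inl a, Inr b) \<in> (adjacency (T - {(a, b)}))\<^sup>*"
  then obtain xs where xs: "xs \<noteq> []" "hd xs = Inl a" "last xs = Inr b" "distinct xs"
    and path: "successively (\<lambda>u v. (u, v) \<in> adjacency (T - {(a, b)})) xs"
    using rtrancl_imp_distinct_path[of "Inl a" "Inr b"] by force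
  \<comment> \<open>The endpoints differ, so length 1 is impossible; length 2 would use the removed
    edge.\<close>
  have "3 \<le> length xs"
    using xs(1-3) path
    by (cases xs; cases "tl xs"; cases "tl (tl xs)") auto
  moreover have "(xs ! k, xs ! (Suc k mod length xs)) \<in> adjacency T" if "k < length xs" for k
  proof (cases "Suc k < length xs")
    case True
    with path have "(xs ! k, xs ! Suc k) \<in> adjacency (T - {(a, b)})"
      by (auto simp: successively_conv_nth)
    with True show ?thesis
      using adjacency_mono[of "T - {(a, b)}" T] by auto
  next
    \<comment> \<open>The last index wraps around: this pair is the closing edge from
      \<open>Inr b\<close> back to \<open>Inl a\<close>.\<close>
    case False
    with that have "k = length xs - 1" "Suc k = length xs" by auto
    with xs e show ?thesis by (simp add: last_conv_nth hd_conv_nth)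
  qed
  ultimately have "is_cycle T xs"
    using xs(4) by (auto simp: is_cycle_def)
  with acyc show False by blast
qed

text \<open>Orients the tree towards the root \<open>r\<close>: \<open>p\<close> gives the parents
  of left vertices, \<open>q\<close> those of right vertices other than \<open>r\<close>. The last
  two properties say that every edge joins a child to its parent, and in one direction only.\<close>

lemma rooted_tree_parents:
  fixes T :: "('m \<times> 'n) set"
  assumes conn: "connected_graph T" and acyc: "\<nexists>vs. is_cycle T vs"
  obtains p q where "\<And>i. (i, p i) \<in> T" "\<And>j. j \<noteq> r \<Longrightarrow> (q j, j) \<in> T"
    "\<And>i j. (i, j) \<in> T \<Longrightarrow> p i = j \<or> j \<noteq> r \<and> q j = i"
    "\<And>j. j \<noteq> r \<Longrightarrow> p (q j) \<noteq> j"
proof -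
  \<comment> \<open>Distance from the root. A parent will be a neighbour strictly closer to the
    root: the last but one vertex of a shortest walk.\<close>
  define d where "d v = (LEAST k. (Inr r, v) \<in> adjacency T ^^ k)" for v
  have reach: "\<exists>k. (Inr r, v) \<in> adjacency T ^^ k" for v
    using conn by (auto simp: connected_graph_def rtrancl_power)
  have "\<exists>u. (u, v) \<in> adjacency T \<and> d u < d v" if "v \<noteq> Inr r" for v
  proof -
    have dv: "(Inr r, v) \<in> adjacency T ^^ d v"
      unfolding d_def by (rule LeastI_ex[OF reach])
    with that have "d v \<noteq> 0" by (intro notI) auto
    then obtain k where k: "d v = Suc k" by (cases "d v") auto
    with dv obtain u where "(Inr r, u) \<in> adjacency T ^^ k" "(u, v) \<in> adjacency T" by auto
    moreover from this have "d u \<le> k"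
      unfolding d_def by (intro Least_le)
    ultimately show ?thesis using k by auto
  qed
  then obtain par where par: "\<And>v. v \<noteq> Inr r \<Longrightarrow> (par v, v) \<in> adjacency T \<and> d (par v) < d v"
    by metis
  define p where "p i = projr (par (Inl i))" for i
  \<comment> \<open>The root has no parent, so \<open>q r\<close> is left unspecified.\<close>
  define q where "q j = projl (par (Inr j))" for j
  have p: "par (Inl i) = Inr (p i)" for i
    using par[of "Inl i"] by (cases "par (Inl i)") (auto simp: p_def)
  have q: "par (Inr j) = Inl (q j)" if "j \<noteq> r" for j
    using par[of "Inr j"] that by (cases "par (Inr j)") (auto simp: q_def)
  show thesis
  proof (rule that[of p q])
    show "(i, p i) \<in> T" for i
      using par[of "Inl i"] by (simp add: p)
    show "(q j, j) \<in> T" if "j \<noteq> r" for j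
      using par[of "Inr j"] that by (simp add: q)
    \<comment> \<open>Passing to the parent decreases \<open>d\<close>, so two such steps cannot
      return to \<open>j\<close>.\<close>
    show "p (q j) \<noteq> j" if "j \<noteq> r" for j
      using par[of "Inr j"] par[of "Inl (q j)"] that by (auto simp: q p)
    show "p i = j \<or> j \<noteq> r \<and> q j = i" if e: "(i, j) \<in> T" for i j
    proof (rule ccontr)
      assume nonpar: "\<not> ?thesis"
      \<comment> \<open>The parent edges alone connect every vertex to the root, but they avoid the bridge \<open>(i, j)\<close>.\<close>
      let ?A = "adjacency (T - {(i, j)})"
      have conn': "(Inr r, v) \<in> ?A\<^sup>*" for v
      proof (induction "d v" arbitrary: v rule: less_induct)
        case less
        show ?case
        proof (cases "v = Inr r")
          case False
          have "(par v, v) \<in> ?A"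
          proof (cases v)
            case (Inl i')
            with par[OF False] nonpar show ?thesis by (auto simp: p)
          next
            case (Inr j')
            with False have "j' \<noteq> r" by auto
            with par[OF False] Inr nonpar show ?thesis by (auto simp: q)
          qed
          with less[of "par v"] par[OF False] show ?thesis
            by (meson rtrancl.rtrancl_into_rtrancl)
        qed auto
      qed
      have "sym (?A\<^sup>*)"
        by (rule sym_rtrancl[OF sym_adjacency])
      then have "(Inl i, Inr j) \<in> ?A\<^sup>*"
        using conn'[of "Inl i"] conn'[of "Inr j"] by (meson symD rtrancl_trans)
      with acyclic_edge_is_bridge[OF acyc e] show False by blast
    qed
  qed
qed

text \<open>The neighbours of \<open>j\<close> are its children, which form the fibre of
  \<open>p\<close> over \<open>j\<close>, and its own parent unless \<open>j\<close> is the root.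
  All neighbours of the root are children, whence the second clause.\<close>

lemma tree_parent_function:
  fixes T :: "('m::finite \<times> 'n::finite) set"
  assumes conn: "connected_graph T" and acyc: "\<nexists>vs. is_cycle T vs"
  shows "\<exists>p. (\<forall>i. (i, p i) \<in> T) \<and> (\<forall>i. (i, r) \<in> T \<longrightarrow> p i = r) \<and>
    (\<forall>j. card {i. (i, j) \<in> T} = card {i. p i = j} + (if j = r then 0 else 1))"
proof -
  obtain p q where pq: "\<And>i. (i, p i) \<in> T" "\<And>j. j \<noteq> r \<Longrightarrow> (q j, j) \<in> T"
    "\<And>i j. (i, j) \<in> T \<Longrightarrow> p i = j \<or> j \<noteq> r \<and> q j = i"
    "\<And>j. j \<noteq> r \<Longrightarrow> p (q j) \<noteq> j"
    by (fact rooted_tree_parents[OF assms])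
  have "card {i. (i, j) \<in> T} = card {i. p i = j} + (if j = r then 0 else 1)" for j
  proof (cases "j = r")
    case True
    with pq(1,3) have "{i. (i, j) \<in> T} = {i. p i = j}" by blast
    with True show ?thesis by simp
  next
    case False
    with pq have "{i. (i, j) \<in> T} = insert (q j) {i. p i = j}" by blast
    with False pq(4) show ?thesis by simp
  qed
  with pq show ?thesis by blast
qed

lemma sum_card_fibres: "(\<Sum>j\<in>UNIV. card {i. p i = j}) = CARD('m)"
  for p :: "'m::finite \<Rightarrow> 'n::finite"
  using sum.group[of "UNIV :: 'm set" "UNIV :: 'n set" p "\<lambda>_. 1 :: nat"] by simp

text \<open>Equivalent to the tree having m + n - 1 edges. The fibres of the parent function
  partition the left vertices, and any root serves.\<close>

lemma sum_right_degree_vector: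
  fixes T :: "('m::finite \<times> 'n::finite) set"
  assumes "connected_graph T" "\<nexists>vs. is_cycle T vs"
  shows "(\<Sum>j\<in>UNIV. right_degree_vector T $ j) = real CARD('m) - 1"
proof -
  obtain r :: 'n where True by simp
  obtain p :: "'m \<Rightarrow> 'n" where p: "\<And>j. card {i. (i, j) \<in> T} = card {i. p i = j} + (if j = r then 0 else 1)"
    using tree_parent_function[OF assms, of r] by metis
  have "right_degree_vector T $ j = real (card {i. p i = j}) - (if j = r then 1 else 0)" for j
    by (simp add: right_degree_vector_def p)
  then have "(\<Sum>j\<in>UNIV. right_degree_vector T $ j) = real (\<Sum>j\<in>UNIV. card {i. p i = j}) - 1"
    by (simp add: sum_subtractf)
  then show ?thesis by (simp add: sum_card_fibres)
qed

section \<open>Polytopes as sets of flows\<close>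

text \<open>Injectivity allows coefficients to be indexed by \<open>I\<close> instead of by points,
  so that they can be read as weights on vertices or edges.\<close>

lemma convex_hull_image_finite:
  fixes f :: "'a \<Rightarrow> 'b::real_vector"
  assumes "finite I" "inj_on f I"
  shows "convex hull (f ` I) =
    {\<Sum>i\<in>I. u i *\<^sub>R f i | u. (\<forall>i\<in>I. 0 \<le> u i) \<and> sum u I = 1}" (is "_ = ?R")
proof
  show "convex hull (f ` I) \<subseteq> ?R"
    using assms unfolding convex_hull_finite[OF finite_imageI[OF assms(1)]]
    by (force simp: sum.reindex)
  show "?R \<subseteq> convex hull (f ` I)"
    using assms by (auto intro!: convex_sum simp: hull_inc)
qed

lemma inj_axis_one: "inj (\<lambda>j. axis j (1 :: real) :: real ^ 'n)"
  by (auto simp: inj_on_def axis_eq_axis)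

lemma coord_simplex_iff:
  "x \<in> coord_simplex I \<longleftrightarrow> (\<forall>j. 0 \<le> x $ j) \<and> (\<forall>j. j \<notin> I \<longrightarrow> x $ j = 0) \<and> (\<Sum>j\<in>UNIV. x $ j) = 1"
proof -
  have coords: "(\<Sum>k\<in>I. u k *\<^sub>R axis k (1::real)) = (\<chi> j. if j \<in> I then u j else 0)"
    for u :: "'a \<Rightarrow> real"
    by (auto simp: vec_eq_iff axis_def if_distrib sum.If_cases cong: if_cong)
  have total: "sum u I = (\<Sum>j\<in>UNIV. if j \<in> I then u j else 0)" for u :: "'a \<Rightarrow> real"
    by (simp add: sum.If_cases)
  have hull: "coord_simplex I =
      {(\<chi> j. if j \<in> I then u j else 0) | u. (\<forall>i\<in>I. 0 \<le> u i) \<and> sum u I = 1}"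
    unfolding coord_simplex_def
    by (subst convex_hull_image_finite) (auto intro: inj_on_subset[OF inj_axis_one] simp: coords)
  show ?thesis
  proof
    assume "x \<in> coord_simplex I"
    then show "(\<forall>j. 0 \<le> x $ j) \<and> (\<forall>j. j \<notin> I \<longrightarrow> x $ j = 0) \<and> (\<Sum>j\<in>UNIV. x $ j) = 1"
      unfolding hull by (auto simp: total)
  next
    assume x: "(\<forall>j. 0 \<le> x $ j) \<and> (\<forall>j. j \<notin> I \<longrightarrow> x $ j = 0) \<and> (\<Sum>j\<in>UNIV. x $ j) = 1"
    then have "x = (\<chi> j. if j \<in> I then x $ j else 0)" by (auto simp: vec_eq_iff)
    moreover have "(\<Sum>j\<in>UNIV. if j \<in> I then x $ j else 0) = (\<Sum>j\<in>UNIV. x $ j)"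
      using x by (intro sum.cong) auto
    then have "sum (($) x) I = 1" using x by (simp add: total)
    ultimately show "x \<in> coord_simplex I"
      unfolding hull using x by (intro CollectI exI[of _ "($) x"]) simp
  qed
qed

text \<open>Row sums are the amounts leaving left vertices, column sums those entering right
  vertices. They are prescribed separately, since P_G fixes every row sum while Q_G fixes only the
  total.\<close>

definition is_flow :: "('m::finite \<times> 'n::finite) set \<Rightarrow> ('m \<Rightarrow> 'n \<Rightarrow> real) \<Rightarrow> bool" where
  "is_flow G w \<longleftrightarrow> (\<forall>i j. 0 \<le> w i j) \<and> (\<forall>i j. (i, j) \<notin> G \<longrightarrow> w i j = 0)"

text \<open>Row \<open>i\<close> of the flow is the summand taken from the \<open>i\<close>-th
  simplex of the Minkowski sum.\<close>

lemma gen_permutohedron_iff: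
  "x \<in> gen_permutohedron G \<longleftrightarrow>
    (\<exists>w. is_flow G w \<and> (\<forall>i. (\<Sum>j\<in>UNIV. w i j) = 1) \<and> (\<forall>j. x $ j = (\<Sum>i\<in>UNIV. w i j)))"
proof
  assume "x \<in> gen_permutohedron G"
  then obtain s where s: "x = (\<Sum>i\<in>UNIV. s i)" "\<And>i. s i \<in> coord_simplex {j. (i, j) \<in> G}"
    unfolding gen_permutohedron_def set_sum_alt[OF finite] by auto
  then show "\<exists>w. is_flow G w \<and> (\<forall>i. (\<Sum>j\<in>UNIV. w i j) = 1) \<and> (\<forall>j. x $ j = (\<Sum>i\<in>UNIV. w i j))"
    by (intro exI[of _ "\<lambda>i j. s i $ j"]) (auto simp: is_flow_def coord_simplex_iff)
next
  assume "\<exists>w. is_flow G w \<and> (\<forall>i. (\<Sum>j\<in>UNIV. w i j) = 1) \<and> (\<forall>j. x $ j = (\<Sum>i\<in>UNIV. w i j))"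
  then obtain w where w: "is_flow G w" "\<And>i. (\<Sum>j\<in>UNIV. w i j) = 1" "\<And>j. x $ j = (\<Sum>i\<in>UNIV. w i j)"
    by blast
  have "x = (\<Sum>i\<in>UNIV. \<chi> j. w i j)" by (simp add: vec_eq_iff w(3))
  moreover have "(\<chi> j. w i j) \<in> coord_simplex {j. (i, j) \<in> G}" for i
    using w by (auto simp: is_flow_def coord_simplex_iff)
  ultimately show "x \<in> gen_permutohedron G"
    unfolding gen_permutohedron_def set_sum_alt[OF finite]
    by (intro CollectI exI[of _ "\<lambda>i. \<chi> j. w i j"]) simp
qed

definition edge_vector :: "'m \<times> 'n \<Rightarrow> real ^ ('m::finite + 'n::finite)" where
  "edge_vector e = axis (Inl (fst e)) 1 - axis (Inr (snd e)) 1"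

lemma edge_vector_nth [simp]:
  "edge_vector e $ Inl i = (if i = fst e then 1 else 0)"
  "edge_vector e $ Inr j = (if j = snd e then -1 else 0)"
  by (auto simp: edge_vector_def axis_def)

lemma inj_edge_vector: "inj edge_vector"
proof (rule injI)
  fix e e' :: "'m::finite \<times> 'n::finite"
  assume eq: "edge_vector e = edge_vector e'"
  have "fst e = fst e'"
    using arg_cong[OF eq, of "\<lambda>v. v $ Inl (fst e)"] by (auto split: if_splits)
  moreover have "snd e = snd e'"
    using arg_cong[OF eq, of "\<lambda>v. v $ Inr (snd e)"] by (auto split: if_splits)
  ultimately show "e = e'" by (simp add: prod_eq_iff)
qed

lemma root_polytope_eq_hull: "root_polytope G = convex hull (edge_vector ` G)"
proof -
  have "{axis (Inl i) 1 - axis (Inr j) 1 | i j. (i, j) \<in> G} = edge_vector ` G"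
    by (force simp: edge_vector_def image_def)
  then show ?thesis by (simp add: root_polytope_def)
qed

lemma vec_sum_eqI:
  fixes x y :: "real ^ ('m::finite + 'n::finite)"
  assumes "\<And>i. x $ Inl i = y $ Inl i" "\<And>j. x $ Inr j = y $ Inr j"
  shows "x = y"
proof -
  have "x $ v = y $ v" for v
    using assms by (cases v) auto
  then show ?thesis by (simp add: vec_eq_iff)
qed

lemma flow_combination_nth:
  fixes G :: "('m::finite \<times> 'n::finite) set"
  assumes "\<forall>i j. (i, j) \<notin> G \<longrightarrow> w i j = 0"
  shows "(\<Sum>e\<in>G. case_prod w e *\<^sub>R edge_vector e) $ Inl i = (\<Sum>j\<in>UNIV. w i j)"
    and "(\<Sum>e\<in>G. case_prod w e *\<^sub>R edge_vector e) $ Inr j = - (\<Sum>i\<in>UNIV. w i j)"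
    and "(\<Sum>e\<in>G. case_prod w e) = (\<Sum>i\<in>UNIV. \<Sum>j\<in>UNIV. w i j)"
proof -
  \<comment> \<open>Since \<open>w\<close> vanishes off \<open>G\<close>, a sum over edges extends
    to all pairs; the three claims are instances of this.\<close>
  have ext: "(\<Sum>e\<in>G. case_prod w e * g e) = (\<Sum>i\<in>UNIV. \<Sum>j\<in>UNIV. w i j * g (i, j))"
    for g :: "'m \<times> 'n \<Rightarrow> real"
  proof -
    have "(\<Sum>e\<in>G. case_prod w e * g e) = (\<Sum>e\<in>UNIV. case_prod w e * g e)"
      using assms by (intro sum.mono_neutral_left) auto
    then show ?thesis
      by (simp add: sum.cartesian_product case_prod_unfold)
  qed
  have nth: "(\<Sum>e\<in>G. case_prod w e *\<^sub>R edge_vector e) $ v =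
      (\<Sum>a\<in>UNIV. \<Sum>b\<in>UNIV. w a b * edge_vector (a, b) $ v)" for v
    by (simp only: ext sum_component vector_scaleR_component real_scaleR_def)
  have "(\<Sum>a\<in>UNIV. \<Sum>b\<in>UNIV. w a b * edge_vector (a, b) $ Inl i) =
      (\<Sum>a\<in>UNIV. if i = a then \<Sum>b\<in>UNIV. w a b else 0)"
    by (intro sum.cong) auto
  then show "(\<Sum>e\<in>G. case_prod w e *\<^sub>R edge_vector e) $ Inl i = (\<Sum>j\<in>UNIV. w i j)"
    by (simp only: nth) simp
  have "(\<Sum>b\<in>UNIV. w a b * edge_vector (a, b) $ Inr j) = - w a j" for a
  proof -
    have "(\<Sum>b\<in>UNIV. w a b * edge_vector (a, b) $ Inr j) = (\<Sum>b\<in>UNIV. if j = b then - w a b else 0)"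
      by (intro sum.cong) auto
    then show ?thesis by simp
  qed
  then show "(\<Sum>e\<in>G. case_prod w e *\<^sub>R edge_vector e) $ Inr j = - (\<Sum>i\<in>UNIV. w i j)"
    by (simp only: nth sum_negf)
  show "(\<Sum>e\<in>G. case_prod w e) = (\<Sum>i\<in>UNIV. \<Sum>j\<in>UNIV. w i j)"
    using ext[of "\<lambda>_. 1"] by simp
qed

text \<open>The flow value on an edge is the coefficient of the corresponding vertex in a convex
  combination.\<close>

lemma root_polytope_iff:
  fixes G :: "('m::finite \<times> 'n::finite) set"
  shows "z \<in> root_polytope G \<longleftrightarrow>
    (\<exists>w. is_flow G w \<and> (\<Sum>i\<in>UNIV. \<Sum>j\<in>UNIV. w i j) = 1 \<and>
      (\<forall>i. z $ Inl i = (\<Sum>j\<in>UNIV. w i j)) \<and> (\<forall>j. z $ Inr j = - (\<Sum>i\<in>UNIV. w i j)))"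
    (is "_ \<longleftrightarrow> ?R")
proof -
  have hull: "root_polytope G =
      {\<Sum>e\<in>G. u e *\<^sub>R edge_vector e | u. (\<forall>e\<in>G. 0 \<le> u e) \<and> sum u G = 1}"
    unfolding root_polytope_eq_hull
    by (intro convex_hull_image_finite finite inj_on_subset[OF inj_edge_vector] subset_UNIV)
  show ?thesis
  proof
    assume "z \<in> root_polytope G"
    then obtain u where u: "z = (\<Sum>e\<in>G. u e *\<^sub>R edge_vector e)" "\<And>e. e \<in> G \<Longrightarrow> 0 \<le> u e" "sum u G = 1"
      unfolding hull by auto
    define w where "w i j = (if (i, j) \<in> G then u (i, j) else 0)" for i j
    have "sum u G = (\<Sum>e\<in>G. case_prod w e)"
      and "(\<Sum>e\<in>G. u e *\<^sub>R edge_vector e) = (\<Sum>e\<in>G. case_prod w e *\<^sub>R edge_vector e)"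
      by (auto simp: w_def intro!: sum.cong)
    moreover have "\<forall>i j. (i, j) \<notin> G \<longrightarrow> w i j = 0" by (simp add: w_def)
    ultimately show ?R
      using u flow_combination_nth[of G w]
      by (intro exI[of _ w]) (auto simp: is_flow_def w_def)
  next
    assume ?R
    then obtain w where w: "is_flow G w" "(\<Sum>i\<in>UNIV. \<Sum>j\<in>UNIV. w i j) = 1"
      "\<And>i. z $ Inl i = (\<Sum>j\<in>UNIV. w i j)" "\<And>j. z $ Inr j = - (\<Sum>i\<in>UNIV. w i j)" by blast
    from w(1) have supp: "\<forall>i j. (i, j) \<notin> G \<longrightarrow> w i j = 0" by (simp add: is_flow_def)
    have "z = (\<Sum>e\<in>G. case_prod w e *\<^sub>R edge_vector e)"
      by (rule vec_sum_eqI) (simp_all only: w flow_combination_nth[of G w, OF supp])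
    moreover have "(\<Sum>e\<in>G. case_prod w e) = 1"
      by (simp only: w flow_combination_nth[of G w, OF supp])
    ultimately show "z \<in> root_polytope G"
      unfolding hull using w(1)
      by (intro CollectI exI[of _ "case_prod w"]) (auto simp: is_flow_def)
  qed
qed

text \<open>A convex combination of finitely many points with all coefficients positive lies in the
  relative interior of their hull.\<close>

lemma positive_flow_in_rel_interior:
  fixes G :: "('m::finite \<times> 'n::finite) set"
  assumes supp: "\<forall>i j. (i, j) \<notin> G \<longrightarrow> w i j = 0"
    and pos: "\<And>i j. (i, j) \<in> G \<Longrightarrow> 0 < w i j"
    and total: "(\<Sum>i\<in>UNIV. \<Sum>j\<in>UNIV. w i j) = 1"
    and "\<And>i. z $ Inl i = (\<Sum>j\<in>UNIV. w i j)" "\<And>j. z $ Inr j = - (\<Sum>i\<in>UNIV. w i j)"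
  shows "z \<in> rel_interior (root_polytope G)"
proof -
  have inj: "inj_on edge_vector G" by (rule inj_on_subset[OF inj_edge_vector]) simp
  have z: "z = (\<Sum>e\<in>G. case_prod w e *\<^sub>R edge_vector e)"
    by (rule vec_sum_eqI) (simp_all only: assms flow_combination_nth[of G w, OF supp])
  have total': "(\<Sum>e\<in>G. case_prod w e) = 1"
    by (simp only: total flow_combination_nth[of G w, OF supp])
  have inv: "the_inv_into G edge_vector (edge_vector e) = e" if "e \<in> G" for e
    using that inj by (rule the_inv_into_f_f[rotated])
  \<comment> \<open>The library fact indexes coefficients by points, so the edge weights are carried
    over along the inverse of \<open>edge_vector\<close>.\<close>
  let ?u = "case_prod w \<circ> the_inv_into G edge_vector"
  have "z \<in> {y |y. \<exists>u. (\<forall>x\<in>edge_vector ` G. 0 < u x) \<and> sum u (edge_vector ` G) = 1 \<and>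
      (\<Sum>x\<in>edge_vector ` G. u x *\<^sub>R x) = y}"
    using pos total' z inj
    by (auto intro!: exI[of _ ?u] simp: sum.reindex inv cong: sum.cong)
  then show ?thesis
    unfolding root_polytope_eq_hull
    using explicit_subset_rel_interior_convex_hull_minimal[of "edge_vector ` G"] by auto
qed

section \<open>Right degree vectors\<close>

text \<open>The Cayley trick: the points of Q_G with all left coordinates 1/m have right coordinates
  -y/m with y in P_G. Here y is \<open>x\<close> plus the barycentre of the coordinate
  simplex.\<close>

definition cayley_point :: "real ^ 'n \<Rightarrow> real ^ ('m::finite + 'n::finite)" where
  "cayley_point x = (\<chi> v. case v of Inl _ \<Rightarrow> 1 / real CARD('m)
    | Inr j \<Rightarrow> - ((x $ j + 1 / real CARD('n)) / real CARD('m)))"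

lemma cayley_point_nth [simp]:
  "(cayley_point x :: real ^ ('m::finite + 'n::finite)) $ Inl i = 1 / real CARD('m)"
  "(cayley_point x :: real ^ ('m::finite + 'n::finite)) $ Inr j =
     - ((x $ j + 1 / real CARD('n)) / real CARD('m))"
  by (auto simp: cayley_point_def)

lemma barycentre_translate_in_gen_permutohedron:
  fixes G :: "('m::finite \<times> 'n::finite) set"
  assumes "x \<in> trimmed_permutohedron G"
  shows "x + (\<chi> j. 1 / real CARD('n)) \<in> gen_permutohedron G"
proof -
  have "(\<chi> j. 1 / real CARD('n)) \<in> coord_simplex (UNIV :: 'n set)"
    by (simp add: coord_simplex_iff)
  with assms show ?thesis by (auto simp: trimmed_permutohedron_def)
qed

lemma cayley_point_in_root_polytope:
  fixes G :: "('m::finite \<times> 'n::finite) set"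
  assumes "x \<in> trimmed_permutohedron G"
  shows "cayley_point x \<in> root_polytope G"
proof -
  obtain w where w: "is_flow G w" "\<And>i. (\<Sum>j\<in>UNIV. w i j) = 1"
    "\<And>j. x $ j + 1 / real CARD('n) = (\<Sum>i\<in>UNIV. w i j)"
    using barycentre_translate_in_gen_permutohedron[OF assms] by (auto simp: gen_permutohedron_iff)
  then show ?thesis
    unfolding root_polytope_iff
    by (intro exI[of _ "\<lambda>i j. w i j / real CARD('m)"])
       (auto simp: is_flow_def sum_divide_distrib[symmetric])
qed

text \<open>Counts the total flow twice: m by rows, and the sum of \<open>x\<close> plus 1 by
  columns, the barycentre contributing the 1.\<close>

lemma sum_trimmed_permutohedron:
  fixes G :: "('m::finite \<times> 'n::finite) set"
  assumes "x \<in> trimmed_permutohedron G"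
  shows "(\<Sum>j\<in>UNIV. x $ j) = real CARD('m) - 1"
proof -
  obtain w where w: "\<And>i. (\<Sum>j\<in>UNIV. w i j) = 1"
    "\<And>j. x $ j + 1 / real CARD('n) = (\<Sum>i\<in>(UNIV :: 'm set). w i j)"
    using barycentre_translate_in_gen_permutohedron[OF assms] by (auto simp: gen_permutohedron_iff)
  have "(\<Sum>j\<in>UNIV. x $ j) + 1 = (\<Sum>j\<in>UNIV. x $ j + 1 / real CARD('n))"
    by (simp add: sum.distrib)
  also have "\<dots> = (\<Sum>i\<in>UNIV. \<Sum>j\<in>UNIV. w i j)"
    unfolding w(2) by (rule sum.swap)
  finally show ?thesis by (simp add: w(1))
qed

lemma right_degree_vector_eqI:
  fixes T :: "('m::finite \<times> 'n::finite) set"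
  assumes tree: "connected_graph T" "\<nexists>vs. is_cycle T vs"
    and int: "\<And>j. x $ j \<in> \<int>"
    and total: "(\<Sum>j\<in>UNIV. x $ j) = real CARD('m) - 1"
    and mem: "cayley_point x \<in> root_polytope T"
  shows "right_degree_vector T = x"
proof -
  let ?m = "real CARD('m)"
  obtain w where w: "is_flow T w" "\<And>i. 1 / ?m = (\<Sum>j\<in>UNIV. w i j)"
    "\<And>j. (x $ j + 1 / real CARD('n)) / ?m = (\<Sum>i\<in>UNIV. w i j)"
    using mem unfolding root_polytope_iff cayley_point_nth neg_equal_iff_equal by blast
  \<comment> \<open>A left vertex emits 1/m in total, so no single edge carries more.\<close>
  have le1: "w i j \<le> 1 / ?m" for i j
    unfolding w(2)[of i] using w(1) by (intro member_le_sum) (auto simp: is_flow_def)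
  have ge: "x $ j \<le> right_degree_vector T $ j" for j
  proof -
    have "(x $ j + 1 / real CARD('n)) / ?m = (\<Sum>i\<in>{i. (i, j) \<in> T}. w i j)"
      unfolding w(3) using w(1) by (intro sum.mono_neutral_right) (auto simp: is_flow_def)
    also have "\<dots> \<le> (\<Sum>i\<in>{i. (i, j) \<in> T}. 1 / ?m)"
      by (intro sum_mono le1)
    finally have "x $ j + 1 / real CARD('n) \<le> real (card {i. (i, j) \<in> T})"
      by (simp add: divide_le_cancel)
    \<comment> \<open>The barycentric shift makes the bound strict, and integrality then gains a
      full unit: the degree of \<open>j\<close> is at least \<open>x $ j + 1\<close>.\<close>
    moreover have "0 < 1 / real CARD('n)" by simp
    ultimately have "x $ j < real (card {i. (i, j) \<in> T})" by linarith
    moreover obtain k where k: "x $ j = of_int k" using int[of j] by (auto elim: Ints_cases)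
    ultimately have "k + 1 \<le> int (card {i. (i, j) \<in> T})" by linarith
    then show ?thesis by (simp add: right_degree_vector_def k)
  qed
  \<comment> \<open>Both vectors have the same coordinate sum, so the coordinatewise inequality is
    an equality.\<close>
  have "(\<Sum>j\<in>UNIV. right_degree_vector T $ j - x $ j) = 0"
    by (simp add: sum_subtractf sum_right_degree_vector[OF tree] total)
  then have "\<forall>j\<in>UNIV. right_degree_vector T $ j - x $ j = 0"
    using ge by (subst (asm) sum_nonneg_eq_0_iff) auto
  then show ?thesis by (simp add: vec_eq_iff)
qed

lemma right_degree_vector_in_trimmed:
  fixes T :: "('m::finite \<times> 'n::finite) set"
  assumes "connected_graph T" "\<nexists>vs. is_cycle T vs" "T \<subseteq> G"
  shows "right_degree_vector T \<in> trimmed_permutohedron G"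
proof -
  obtain p where p: "\<And>r i. (i, p r i) \<in> T"
    "\<And>r j. card {i. (i, j) \<in> T} = card {i. p r i = j} + (if j = r then 0 else 1)"
    using tree_parent_function[OF assms(1,2)] by metis
  have "right_degree_vector T + y \<in> gen_permutohedron G" if y: "y \<in> coord_simplex UNIV" for y
  proof -
    \<comment> \<open>The parent flow for root \<open>r\<close> realises the degree vector plus the
      unit vector at \<open>r\<close>. Weighting these flows by \<open>y $ r\<close> realises the
      degree vector plus \<open>y\<close>.\<close>
    let ?w = "\<lambda>i j. \<Sum>r\<in>UNIV. y $ r * of_bool (p r i = j)"
    have "is_flow G ?w"
      using y p(1) assms(3) by (auto simp: is_flow_def coord_simplex_iff intro!: sum_nonneg sum.neutral)
    moreover have "(\<Sum>j\<in>UNIV. ?w i j) = 1" for i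
      using y by (subst sum.swap) (simp add: sum_distrib_left[symmetric] coord_simplex_iff)
    moreover have "(right_degree_vector T + y) $ j = (\<Sum>i\<in>UNIV. ?w i j)" for j
    proof -
      have "(\<Sum>i\<in>UNIV. ?w i j) = (\<Sum>r\<in>UNIV. y $ r * real (card {i. p r i = j}))"
        by (subst sum.swap) (simp add: sum_distrib_left[symmetric])
      also have "\<dots> = (\<Sum>r\<in>UNIV. y $ r * right_degree_vector T $ j + (if j = r then y $ r else 0))"
      proof (rule sum.cong[OF refl])
        fix r
        show "y $ r * real (card {i. p r i = j}) =
            y $ r * right_degree_vector T $ j + (if j = r then y $ r else 0)"
          using p(2)[of j r] by (auto simp: right_degree_vector_def algebra_simps)
      qed
      also have "\<dots> = right_degree_vector T $ j + y $ j"
        using y by (simp add: sum.distrib sum_distrib_right[symmetric] coord_simplex_iff)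
      finally show ?thesis by simp
    qed
    ultimately show ?thesis unfolding gen_permutohedron_iff by blast
  qed
  then show ?thesis by (auto simp: trimmed_permutohedron_def)
qed

lemma cayley_point_in_rel_interior:
  fixes T :: "('m::finite \<times> 'n::finite) set"
  assumes "connected_graph T" "\<nexists>vs. is_cycle T vs"
  shows "cayley_point (right_degree_vector T) \<in> rel_interior (root_polytope T)"
proof -
  obtain p where p: "\<And>r i. (i, p r i) \<in> T" "\<And>r i. (i, r) \<in> T \<Longrightarrow> p r i = r"
    "\<And>r j. card {i. (i, j) \<in> T} = card {i. p r i = j} + (if j = r then 0 else 1)"
    using tree_parent_function[OF assms] by metis
  \<comment> \<open>The factor 1/n averages the parent flows over all roots; the factor 1/m
    normalises the total flow to 1.\<close>
  define c where "c = 1 / (real CARD('m) * real CARD('n))"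
  have c: "real CARD('n) * c = 1 / real CARD('m)" "0 < c"
    by (auto simp: c_def)
  let ?w = "\<lambda>i j. \<Sum>r\<in>UNIV. c * of_bool (p r i = j)"
  have row: "(\<Sum>j\<in>UNIV. ?w i j) = 1 / real CARD('m)" for i
    by (subst sum.swap) (simp add: sum_distrib_left[symmetric] c)
  have col: "(\<Sum>i\<in>UNIV. ?w i j) =
    (right_degree_vector T $ j + 1 / real CARD('n)) / real CARD('m)" for j
  proof -
    have "(\<Sum>i\<in>UNIV. ?w i j) = (\<Sum>r\<in>UNIV. c * real (card {i. p r i = j}))"
      by (subst sum.swap) (simp add: sum_distrib_left[symmetric])
    also have "\<dots> = (\<Sum>r\<in>UNIV. c * right_degree_vector T $ j + (if j = r then c else 0))"
    proof (rule sum.cong[OF refl])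
      fix r
      show "c * real (card {i. p r i = j}) =
          c * right_degree_vector T $ j + (if j = r then c else 0)"
        using p(3)[of j r] by (auto simp: right_degree_vector_def algebra_simps)
    qed
    also have "\<dots> = (right_degree_vector T $ j + 1 / real CARD('n)) / real CARD('m)"
      by (simp add: sum.distrib c mult.assoc[symmetric]) (simp add: c_def field_simps)
    finally show ?thesis .
  qed
  show ?thesis
  proof (rule positive_flow_in_rel_interior[where w = ?w])
    show "\<forall>i j. (i, j) \<notin> T \<longrightarrow> ?w i j = 0"
      using p(1) by (auto intro!: sum.neutral)
    \<comment> \<open>When the tree is rooted at \<open>j\<close>, its neighbour \<open>i\<close>
      sends its unit to \<open>j\<close>, so the summand for \<open>r = j\<close> is
      positive.\<close>
    show "0 < ?w i j" if "(i, j) \<in> T" for i j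
      using p(2)[OF that] by (intro sum_pos2[of _ j]) (auto simp: c(2) less_imp_le)
  qed (simp_all only: row col cayley_point_nth, simp_all)
qed

lemma right_degree_vectors_of_triangulation:
  fixes G :: "('m::finite \<times> 'n::finite) set"
  assumes tri: "root_triangulation G s T"
  shows "(\<lambda>k. right_degree_vector (T k)) ` {1..s} = lattice_points (trimmed_permutohedron G)"
    and "inj_on (\<lambda>k. right_degree_vector (T k)) {1..s}"
proof -
  have tree: "T k \<subseteq> G" "connected_graph (T k)" "\<nexists>vs. is_cycle (T k) vs" if "k \<in> {1..s}" for k
    using tri that by (auto simp: root_triangulation_def spanning_tree_def)
  show "(\<lambda>k. right_degree_vector (T k)) ` {1..s} = lattice_points (trimmed_permutohedron G)"
  proof (intro equalityI subsetI)
    fix x assume "x \<in> (\<lambda>k. right_degree_vector (T k)) ` {1..s}"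
    then show "x \<in> lattice_points (trimmed_permutohedron G)"
      using right_degree_vector_in_trimmed[OF tree(2,3,1)]
      by (auto simp: lattice_points_def right_degree_vector_def)
  next
    fix x assume x: "x \<in> lattice_points (trimmed_permutohedron G)"
    then have "cayley_point x \<in> root_polytope G"
      by (simp add: lattice_points_def cayley_point_in_root_polytope)
    then obtain k where k: "k \<in> {1..s}" "cayley_point x \<in> root_polytope (T k)"
      using tri by (auto simp: root_triangulation_def)
    have "right_degree_vector (T k) = x"
      using x k by (intro right_degree_vector_eqI tree sum_trimmed_permutohedron[of x G])
        (auto simp: lattice_points_def)
    with k show "x \<in> (\<lambda>k. right_degree_vector (T k)) ` {1..s}" by blast
  qed
  \<comment> \<open>Equal degree vectors give both simplices the same Cayley point. Their
    intersection is a face of the first one that meets its relative interior, hence is all of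
    it.\<close>
  have sub: "root_polytope (T k) \<subseteq> root_polytope (T l)"
    if kl: "k \<in> {1..s}" "l \<in> {1..s}" and eq: "right_degree_vector (T k) = right_degree_vector (T l)"
    for k l
  proof -
    let ?z = "cayley_point (right_degree_vector (T k))"
    have z: "?z \<in> rel_interior (root_polytope (T k))" "?z \<in> rel_interior (root_polytope (T l))"
      using kl cayley_point_in_rel_interior[OF tree(2,3)] eq by metis+
    then have "?z \<in> root_polytope (T k) \<inter> root_polytope (T l)"
      using rel_interior_subset by blast
    moreover have "(root_polytope (T k) \<inter> root_polytope (T l)) face_of root_polytope (T k)"
      using tri kl by (auto simp: root_triangulation_def)
    ultimately show ?thesis
      using subset_of_face_of[of _ "root_polytope (T k)" "root_polytope (T k)"] z(1) by blast
  qed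
  show "inj_on (\<lambda>k. right_degree_vector (T k)) {1..s}"
  proof (rule inj_onI)
    fix k l assume kl: "k \<in> {1..s}" "l \<in> {1..s}"
      "right_degree_vector (T k) = right_degree_vector (T l)"
    have inj: "inj_on (\<lambda>k. root_polytope (T k)) {1..s}"
      using tri by (simp add: root_triangulation_def)
    have "root_polytope (T k) = root_polytope (T l)"
      using sub[of k l] sub[of l k] kl by auto
    then show "k = l" by (rule inj_onD[OF inj _ kl(1,2)])
  qed
qed

section \<open>Mirror images\<close>

definition swap_vertex :: "'a + 'b \<Rightarrow> 'b + 'a" where
  "swap_vertex v = (case v of Inl a \<Rightarrow> Inr a | Inr b \<Rightarrow> Inl b)"

lemma swap_vertex_simps [simp]: "swap_vertex (Inl a) = Inr a" "swap_vertex (Inr b) = Inl b"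
  and swap_vertex_swap_vertex [simp]: "swap_vertex (swap_vertex v) = v"
  by (auto simp: swap_vertex_def split: sum.split)

lemma adjacency_converse_iff: "(swap_vertex u, swap_vertex v) \<in> adjacency (G\<inverse>) \<longleftrightarrow> (u, v) \<in> adjacency G"
  by (cases u; cases v) auto

lemma connected_graph_converse:
  assumes "connected_graph G"
  shows "connected_graph (G\<inverse>)"
proof -
  have step: "(swap_vertex u, swap_vertex v) \<in> (adjacency (G\<inverse>))\<^sup>*" if "(u, v) \<in> (adjacency G)\<^sup>*" for u v
    using that
  proof (induction rule: rtrancl_induct)
    case (step y z)
    then show ?case
      using adjacency_converse_iff[of y z G] by (auto intro: rtrancl_into_rtrancl)
  qed simp
  have "(u, v) \<in> (adjacency (G\<inverse>))\<^sup>*" for u v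
    using step[of "swap_vertex u" "swap_vertex v"] assms by (simp add: connected_graph_def)
  then show ?thesis by (simp add: connected_graph_def)
qed

lemma is_cycle_converse:
  assumes "is_cycle G vs"
  shows "is_cycle (G\<inverse>) (map swap_vertex vs)"
proof -
  have "inj_on swap_vertex (set vs)"
    by (intro inj_onI) (metis swap_vertex_swap_vertex)
  moreover have "Suc k mod length vs < length vs" if "k < length vs" for k
    using that by (intro mod_less_divisor) auto
  ultimately show ?thesis
    using assms by (auto simp: is_cycle_def distinct_map adjacency_converse_iff)
qed

lemma spanning_tree_converse:
  assumes "spanning_tree G T"
  shows "spanning_tree (G\<inverse>) (T\<inverse>)"
  using assms connected_graph_converse[of T] is_cycle_converse[of "T\<inverse>"]
  by (auto simp: spanning_tree_def)

text \<open>Swapping the two blocks of coordinates reverses the sign of every edge vector; the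
  negation restores it.\<close>

definition mirror :: "real ^ ('m::finite + 'n::finite) \<Rightarrow> real ^ ('n + 'm)" where
  "mirror z = (\<chi> v. - z $ swap_vertex v)"

lemma linear_mirror: "linear mirror"
  by (auto simp: mirror_def linear_iff vec_eq_iff)

lemma mirror_mirror [simp]: "mirror (mirror z) = z"
  by (simp add: mirror_def vec_eq_iff)

lemma inj_mirror: "inj mirror"
  by (metis injI mirror_mirror)

lemma root_polytope_converse:
  fixes G :: "('m::finite \<times> 'n::finite) set"
  shows "root_polytope (G\<inverse>) = mirror ` root_polytope G"
proof -
  have "mirror (edge_vector e) = edge_vector (prod.swap e)" for e :: "'m \<times> 'n"
    by (rule vec_sum_eqI) (auto simp: mirror_def)
  moreover have "G\<inverse> = prod.swap ` G"
    by force
  ultimately have "edge_vector ` (G\<inverse>) = mirror ` edge_vector ` G"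
    by (simp add: image_image)
  then show ?thesis
    unfolding root_polytope_eq_hull
    by (simp add: convex_hull_linear_image[OF linear_mirror])
qed

text \<open>As an injective linear map, \<open>mirror\<close> preserves distinctness, unions,
  intersections and faces.\<close>

lemma root_triangulation_converse:
  assumes "root_triangulation G s T"
  shows "root_triangulation (G\<inverse>) s (\<lambda>k. (T k)\<inverse>)"
proof -
  have "inj_on (\<lambda>k. mirror ` root_polytope (T k)) {1..s}"
    using assms unfolding root_triangulation_def inj_on_def inj_image_eq_iff[OF inj_mirror] by blast
  moreover have "mirror ` root_polytope G = (\<Union>k\<in>{1..s}. mirror ` root_polytope (T k))"
    using assms unfolding root_triangulation_def by (metis image_UN)
  moreover have "\<forall>k\<in>{1..s}. spanning_tree (G\<inverse>) ((T k)\<inverse>)"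
    using assms by (simp add: root_triangulation_def spanning_tree_converse)
  ultimately show ?thesis
    using assms
    unfolding root_triangulation_def root_polytope_converse image_Int[OF inj_mirror, symmetric]
      face_of_linear_image[OF linear_mirror inj_mirror]
    by simp
qed

lemma right_degree_vector_converse: "right_degree_vector (T\<inverse>) = left_degree_vector T"
  by (simp add: right_degree_vector_def left_degree_vector_def)

theorem theorem12p9:
  fixes G :: "('m::finite \<times> 'n::finite) set"
    and s :: nat
    and T :: "nat \<Rightarrow> ('m \<times> 'n) set"
  assumes "connected_graph G"
    and "root_triangulation G s T"
  shows "(\<lambda>k. right_degree_vector (T k)) ` {1..s} = lattice_points (trimmed_permutohedron G)
       \<and> inj_on (\<lambda>k. right_degree_vector (T k)) {1..s}
       \<and> (\<lambda>k. left_degree_vector (T k)) ` {1..s} = lattice_points (trimmed_permutohedron (G\<inverse>))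
       \<and> inj_on (\<lambda>k. left_degree_vector (T k)) {1..s}"
  \<comment> \<open>Left degrees of a tree are right degrees of its mirror image, so the second half
    is the first half applied to the mirrored triangulation.\<close>
  using right_degree_vectors_of_triangulation[OF assms(2)]
    right_degree_vectors_of_triangulation[OF root_triangulation_converse[OF assms(2)]]
  by (simp add: right_degree_vector_converse)

end
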